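(* Let $\boldsymbol{d}$ be a coherent online true discovery procedure. Define $$\phi_S=\mathbb{1}\{\boldsymbol{d}(S)>0\}\ \text{ for all finite } S\subseteq\mathbb{N},\qquad \phi_J=\sup\{\phi_S: S\subseteq J,\ S \text{ finite}\}\ \text{ for all infinite } J\subseteq \mathbb{N}.$$ Then $\boldsymbol{\phi}=(\phi_I)_{I\subseteq\mathbb{N}}$ is an increasing family of online intersection tests, and $\boldsymbol{d}^{\boldsymbol{\phi}}\geq \boldsymbol{d}$, i.e. $\boldsymbol{d}^{\boldsymbol{\phi}}(S)\ge \boldsymbol{d}(S)$ for every finite $S\subseteq\mathbb{N}$.
   Context: Setting. $\mathbb{N}=\{1,2,\ldots\}$, $\alpha\in(0,1)$ is fixed, $\Omega$ is equipped with a filtration $(\mathcal{F}_i)_{i\in\mathbb{N}_0}$ with $\mathcal{F}_0=\{\emptyset,\Omega\}$ and $\mathcal F_\infty=\sigma(\bigcup_i\mathcal F_i)$, and $\mathcal{P}$ is a nonempty set of probability distributions on $(\Omega,\mathcal F_\infty)$. Null hypotheses are subsets $H_1,H_2,\ldots\subseteq\mathcal{P}$. For $\mathbb{P}\in\mathcal{P}$: $I_0^{\mathbb{P}}=\{i\in\mathbb{N}:\mathbb{P}\in H_i\}$ and $I_1^{\mathbb{P}}=\mathbb{N}\setminus I_0^{\mathbb{P}}$. For $I\subseteq\mathbb{N}$, $H_I=\bigcap_{i\in I}H_i$ (with $H_\emptyset=\mathcal{P}$). True discovery procedure: a random function $\boldsymbol{d}$ from the finite subsets of $\mathbb{N}$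 to $\mathbb{N}\cup\{0\}$ such that for all $\mathbb{P}\in\mathcal{P}$, $\mathbb{P}(\boldsymbol{d}(S)\le |S\cap I_1^{\mathbb{P}}|\text{ for all finite }S\subseteq\mathbb{N})\ge 1-\alpha$. It is online if $\boldsymbol{d}(S)$ is $\mathcal{F}_{\max(S)}$-measurable for every finite $S$ (with $\max(\emptyset)=0$). It is coherent if for all disjoint finite $S,U\subseteq\mathbb{N}$, $\boldsymbol{d}(S)+\boldsymbol{d}(U)\le \boldsymbol{d}(S\cup U)\le \boldsymbol{d}(S)+|U|$. Intersection test for $H_I$: a $\{0,1\}$-valued random variable $\phi_I$ with $\mathbb{P}(\phi_I=1)\le\alpha$ for all $\mathbb{P}\in H_I$. It is an online intersection test if it is $\mathcal{F}_{\sup(I)}$-measurable (with $\sup(\emptyset)=0$; $\mathcal F_\infty$ if $I$ is infinite). A family $(\phi_I)_{I\subseteq\mathbb{N}}$ is increasing if for all $i\in\mathbb{N}$, $I\subseteq\{1,\ldots,i\}$ and $K\subseteq\{k\in\mathbb{N}:k>i\}$ one has $\phi_I\le\phi_{I\cup K}$. Closed procedure of a family of intersection tests: $\boldsymbol{d}^{\boldsymbol{\phi}}(S)=\inf\{|S\setminus I|: I\subseteq\mathbb{N},\ \phi_I=0\}$ for finite $S\subseteq\mathbb{N}$. *)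

theory Defs
  imports "HOL-Probability.Probability"
begin

text \<open>
  The index set of the hypotheses is \<open>{1, 2, \<dots>}\<close>, written \<open>{1..}\<close>; index \<open>0\<close> only occurs as a time
  of the filtration. Families indexed by sets of hypotheses are functions on all of \<open>nat set\<close>, but
  only their values at subsets of \<open>{1..}\<close> are ever constrained or used. Likewise, functions of the
  outcome are only relevant on \<open>\<Omega>\<close>.
\<close>

definition limit_algebra :: "'a set \<Rightarrow> (nat \<Rightarrow> 'a measure) \<Rightarrow> 'a measure" where
  "limit_algebra \<Omega> F = sigma \<Omega> (\<Union>i. sets (F i))"

locale online_testing = filtration \<Omega> F
  for \<Omega> :: "'a set" and F :: "nat \<Rightarrow> 'a measure" +
  fixes \<alpha> :: real and \<P> :: "'a measure set" and H :: "nat \<Rightarrow> 'a measure set"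
  assumes level: "0 < \<alpha>" "\<alpha> < 1"
    and trivial_start: "sets (F 0) = {{}, \<Omega>}"
    and nonempty: "\<P> \<noteq> {}"
    and distributions: "\<And>P. P \<in> \<P> \<Longrightarrow> prob_space P \<and> sets P = sets (limit_algebra \<Omega> F)"
    and hypotheses: "\<And>i. i \<ge> 1 \<Longrightarrow> H i \<subseteq> \<P>"

definition true_nulls :: "(nat \<Rightarrow> 'a measure set) \<Rightarrow> 'a measure \<Rightarrow> nat set" where
  "true_nulls H P = {i \<in> {1..}. P \<in> H i}"

definition false_nulls :: "(nat \<Rightarrow> 'a measure set) \<Rightarrow> 'a measure \<Rightarrow> nat set" where
  "false_nulls H P = {1..} - true_nulls H P"

text \<open>Intersecting with \<open>\<P>\<close> gives \<open>H\<^sub>I = \<P>\<close> for \<open>I = {}\<close>.\<close>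

definition intersection_hypothesis ::
    "'a measure set \<Rightarrow> (nat \<Rightarrow> 'a measure set) \<Rightarrow> nat set \<Rightarrow> 'a measure set" where
  "intersection_hypothesis \<P> H I = \<P> \<inter> (\<Inter>i\<in>I. H i)"

text \<open>The sigma-algebra at time \<open>sup I\<close>. On \<open>nat\<close>, \<open>Sup {} = 0\<close> and \<open>Sup I = Max I\<close> for finite
  nonempty \<open>I\<close>.\<close>

definition algebra_at :: "'a set \<Rightarrow> (nat \<Rightarrow> 'a measure) \<Rightarrow> nat set \<Rightarrow> 'a measure" where
  "algebra_at \<Omega> F I = (if finite I then F (Sup I) else limit_algebra \<Omega> F)"

definition true_discovery_procedure ::
    "'a set \<Rightarrow> (nat \<Rightarrow> 'a measure) \<Rightarrow> real \<Rightarrow> 'a measure set \<Rightarrow> (nat \<Rightarrow> 'a measure set)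
      \<Rightarrow> (nat set \<Rightarrow> 'a \<Rightarrow> nat) \<Rightarrow> bool" where
  "true_discovery_procedure \<Omega> F \<alpha> \<P> H d \<longleftrightarrow>
    (\<forall>S. finite S \<and> S \<subseteq> {1..} \<longrightarrow> d S \<in> limit_algebra \<Omega> F \<rightarrow>\<^sub>M count_space UNIV) \<and>
    (\<forall>P\<in>\<P>. measure P {\<omega> \<in> \<Omega>. \<forall>S. finite S \<and> S \<subseteq> {1..} \<longrightarrow> d S \<omega> \<le> card (S \<inter> false_nulls H P)}
             \<ge> 1 - \<alpha>)"

definition online_procedure ::
    "'a set \<Rightarrow> (nat \<Rightarrow> 'a measure) \<Rightarrow> (nat set \<Rightarrow> 'a \<Rightarrow> nat) \<Rightarrow> bool" where
  "online_procedure \<Omega> F d \<longleftrightarrow>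
    (\<forall>S. finite S \<and> S \<subseteq> {1..} \<longrightarrow> d S \<in> algebra_at \<Omega> F S \<rightarrow>\<^sub>M count_space UNIV)"

definition coherent_procedure :: "'a set \<Rightarrow> (nat set \<Rightarrow> 'a \<Rightarrow> nat) \<Rightarrow> bool" where
  "coherent_procedure \<Omega> d \<longleftrightarrow>
    (\<forall>S U. finite S \<and> finite U \<and> S \<subseteq> {1..} \<and> U \<subseteq> {1..} \<and> S \<inter> U = {} \<longrightarrow>
      (\<forall>\<omega>\<in>\<Omega>. d S \<omega> + d U \<omega> \<le> d (S \<union> U) \<omega> \<and> d (S \<union> U) \<omega> \<le> d S \<omega> + card U))"

definition intersection_test ::
    "'a set \<Rightarrow> (nat \<Rightarrow> 'a measure) \<Rightarrow> real \<Rightarrow> 'a measure set \<Rightarrow> (nat \<Rightarrow> 'a measure set)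
      \<Rightarrow> nat set \<Rightarrow> ('a \<Rightarrow> nat) \<Rightarrow> bool" where
  "intersection_test \<Omega> F \<alpha> \<P> H I t \<longleftrightarrow>
    t \<in> limit_algebra \<Omega> F \<rightarrow>\<^sub>M count_space UNIV \<and>
    (\<forall>\<omega>\<in>\<Omega>. t \<omega> \<in> {0, 1}) \<and>
    (\<forall>P\<in>intersection_hypothesis \<P> H I. measure P {\<omega> \<in> \<Omega>. t \<omega> = 1} \<le> \<alpha>)"

definition online_intersection_test ::
    "'a set \<Rightarrow> (nat \<Rightarrow> 'a measure) \<Rightarrow> real \<Rightarrow> 'a measure set \<Rightarrow> (nat \<Rightarrow> 'a measure set)
      \<Rightarrow> nat set \<Rightarrow> ('a \<Rightarrow> nat) \<Rightarrow> bool" where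
  "online_intersection_test \<Omega> F \<alpha> \<P> H I t \<longleftrightarrow>
    intersection_test \<Omega> F \<alpha> \<P> H I t \<and> t \<in> algebra_at \<Omega> F I \<rightarrow>\<^sub>M count_space UNIV"

definition increasing_family :: "'a set \<Rightarrow> (nat set \<Rightarrow> 'a \<Rightarrow> nat) \<Rightarrow> bool" where
  "increasing_family \<Omega> \<phi> \<longleftrightarrow>
    (\<forall>i\<ge>1. \<forall>I K. I \<subseteq> {1..i} \<and> K \<subseteq> {i<..} \<longrightarrow> (\<forall>\<omega>\<in>\<Omega>. \<phi> I \<omega> \<le> \<phi> (I \<union> K) \<omega>))"

text \<open>The infimum is taken in \<open>enat\<close>, so that it is infinite when no intersection test accepts;
  on \<open>nat\<close> the infimum of the empty set would be unspecified. For online intersection tests this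
  case does not arise: \<open>\<phi> {}\<close> is then constant on \<open>\<Omega>\<close>, and equal to \<open>0\<close> because \<open>\<alpha> < 1\<close>.\<close>

definition closed_procedure :: "(nat set \<Rightarrow> 'a \<Rightarrow> nat) \<Rightarrow> nat set \<Rightarrow> 'a \<Rightarrow> enat" where
  "closed_procedure \<phi> S \<omega> = Inf {enat (card (S - I)) | I. I \<subseteq> {1..} \<and> \<phi> I \<omega> = 0}"

definition induced_tests :: "(nat set \<Rightarrow> 'a \<Rightarrow> nat) \<Rightarrow> nat set \<Rightarrow> 'a \<Rightarrow> nat" where
  "induced_tests d J \<omega> =
    (if finite J then of_bool (d J \<omega> > 0)
     else (SUP S\<in>{S. S \<subseteq> J \<and> finite S}. of_bool (d S \<omega> > 0)))"

end

theory Submission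
  imports Defs
begin

text \<open>Coherence is used in two ways. Its lower half, together with \<open>d \<ge> 0\<close>,
  makes \<open>d\<close> monotone in the set; its upper half says that removing the indices outside
  \<open>I\<close> from \<open>S\<close> lowers \<open>d\<close> by at most
  \<open>card (S - I)\<close>. By monotonicity, the test of any \<open>J\<close>, finite or
  infinite, rejects iff \<open>d\<close> is positive on some finite subset of \<open>J\<close>.
  Level: under \<open>P\<close> in the intersection hypothesis of \<open>I\<close>, no subset of
  \<open>I\<close> contains a false null, so on the event that all bounds of \<open>d\<close> hold,
  \<open>d\<close> vanishes on the finite subsets of \<open>I\<close>. Rejection is thus disjoint
  from one event of probability at least \<open>1 - \<alpha>\<close>; as the bounds hold
  simultaneously, infinite \<open>I\<close> costs nothing extra. The family increases because a
  rejecting subset of \<open>I\<close> is also a subset of \<open>I \<union> K\<close>. Finally, if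
  the test of \<open>I\<close> accepts, then \<open>d (S \<inter> I) = 0\<close>, hence
  \<open>d S \<le> card (S - I)\<close>; the infimum over such \<open>I\<close> is the closed
  procedure.\<close>

lemma space_limit_algebra:
  assumes "filtration \<Omega> F"
  shows "space (limit_algebra \<Omega> F) = \<Omega>"
proof -
  have "sets (F i) \<subseteq> Pow \<Omega>" for i
    using sets.space_closed[of "F i"] assms by (simp add: filtration.space_F)
  then show ?thesis
    unfolding limit_algebra_def by (intro space_measure_of) auto
qed

lemma coherent_procedure_mono:
  assumes "coherent_procedure \<Omega> d" "\<omega> \<in> \<Omega>" "finite T" "T \<subseteq> {1..}" "S \<subseteq> T"
  shows "d S \<omega> \<le> d T \<omega>"
proof -
  have "finite S \<and> finite (T - S) \<and> S \<subseteq> {1..} \<and> T - S \<subseteq> {1..} \<and> S \<inter> (T - S) = {}"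
    using assms(3-5) by (auto intro: finite_subset)
  then have "d S \<omega> + d (T - S) \<omega> \<le> d (S \<union> (T - S)) \<omega>"
    using assms(1,2) unfolding coherent_procedure_def by blast
  moreover have "S \<union> (T - S) = T"
    using assms(5) by blast
  ultimately show ?thesis
    by simp
qed

text \<open>The upper half of coherence for the splitting of \<open>S\<close> along
  \<open>I\<close>; the first summand vanishes once the test of \<open>I\<close> accepts.\<close>

lemma coherent_procedure_le:
  assumes "coherent_procedure \<Omega> d" "\<omega> \<in> \<Omega>" "finite S" "S \<subseteq> {1..}"
  shows "d S \<omega> \<le> d (S \<inter> I) \<omega> + card (S - I)"
proof -
  have "finite (S \<inter> I) \<and> finite (S - I) \<and> S \<inter> I \<subseteq> {1..} \<and> S - I \<subseteq> {1..} \<and>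
      (S \<inter> I) \<inter> (S - I) = {}"
    using assms(3,4) by auto
  then have "d ((S \<inter> I) \<union> (S - I)) \<omega> \<le> d (S \<inter> I) \<omega> + card (S - I)"
    using assms(1,2) unfolding coherent_procedure_def by blast
  then show ?thesis
    by (simp add: Int_Diff_Un)
qed

text \<open>Turns the supremum in \<open>induced_tests\<close> into an existential statement, from
  which measurability and order can be read off.\<close>

lemma SUP_of_bool_nat:
  assumes "A \<noteq> {}"
  shows "(SUP x\<in>A. of_bool (P x) :: nat) = of_bool (\<exists>x\<in>A. P x)"
proof (rule cSup_eq_non_empty)
  show "(\<lambda>x. of_bool (P x) :: nat) ` A \<noteq> {}"
    using assms by simp
  show "y \<le> of_bool (\<exists>x\<in>A. P x)" if "y \<in> (\<lambda>x. of_bool (P x)) ` A" for y :: nat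
    using that by auto
  show "of_bool (\<exists>x\<in>A. P x) \<le> z"
    if "\<And>y. y \<in> (\<lambda>x. of_bool (P x)) ` A \<Longrightarrow> y \<le> z" for z :: nat
    using that by (auto simp: of_bool_def split: if_splits)
qed

text \<open>By monotonicity of \<open>d\<close>, the formula defining the tests of infinite intersections also holds
  for finite ones.\<close>

lemma induced_tests_eq:
  assumes "coherent_procedure \<Omega> d" "\<omega> \<in> \<Omega>" "J \<subseteq> {1..}"
  shows "induced_tests d J \<omega> = of_bool (\<exists>S\<in>{S. finite S \<and> S \<subseteq> J}. d S \<omega> > 0)"
proof (cases "finite J")
  case True
  have "(\<exists>S\<in>{S. finite S \<and> S \<subseteq> J}. d S \<omega> > 0) \<longleftrightarrow> d J \<omega> > 0"
    using coherent_procedure_mono[OF assms(1,2) True assms(3)] True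
    by (auto intro: less_le_trans)
  with True show ?thesis
    by (simp add: induced_tests_def)
next
  case False
  have "{S. S \<subseteq> J \<and> finite S} \<noteq> {}"
    by blast
  from SUP_of_bool_nat[OF this, of "\<lambda>S. d S \<omega> > 0"] False show ?thesis
    by (simp add: induced_tests_def conj_commute)
qed

text \<open>A set of naturals has only countably many finite subsets, so the rejection event is a
  countable union of events.\<close>

lemma measurable_induced_tests:
  assumes "coherent_procedure \<Omega> d" "J \<subseteq> {1..}" "space M = \<Omega>"
    and "\<And>S. finite S \<Longrightarrow> S \<subseteq> J \<Longrightarrow> d S \<in> M \<rightarrow>\<^sub>M count_space UNIV"
  shows "induced_tests d J \<in> M \<rightarrow>\<^sub>M count_space UNIV"
proof -
  have "countable {S. finite S \<and> S \<subseteq> J}"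
    by (intro countable_Collect_finite_subset) simp
  moreover have "Measurable.pred M (\<lambda>\<omega>. d S \<omega> > 0)" if "finite S" "S \<subseteq> J" for S
    using assms(4)[OF that] by measurable
  ultimately have "Measurable.pred M (\<lambda>\<omega>. \<exists>S\<in>{S. finite S \<and> S \<subseteq> J}. d S \<omega> > 0)"
    unfolding pred_def by (intro sets.sets_Collect_countable_Ex') auto
  then have "(\<lambda>\<omega>. of_bool (\<exists>S\<in>{S. finite S \<and> S \<subseteq> J}. d S \<omega> > 0) :: nat)
      \<in> M \<rightarrow>\<^sub>M count_space UNIV"
    by measurable
  then show ?thesis
    \<comment> \<open>The two functions need to agree only on \<open>\<Omega>\<close>, the space of
      \<open>M\<close>, which is where coherence holds.\<close>
    using assms(1-3) by (subst measurable_cong[OF induced_tests_eq]) auto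
qed

lemma intersection_test_induced_tests:
  assumes "online_testing \<Omega> F \<alpha> \<P> H" "true_discovery_procedure \<Omega> F \<alpha> \<P> H d"
    and "coherent_procedure \<Omega> d" "I \<subseteq> {1..}"
  shows "intersection_test \<Omega> F \<alpha> \<P> H I (induced_tests d I)"
proof -
  interpret online_testing \<Omega> F \<alpha> \<P> H
    by (rule assms(1))
  have space: "space (limit_algebra \<Omega> F) = \<Omega>"
    by (rule space_limit_algebra) (rule filtration_axioms)
  have meas: "induced_tests d I \<in> limit_algebra \<Omega> F \<rightarrow>\<^sub>M count_space UNIV"
    using assms(2,4)
    by (intro measurable_induced_tests[OF assms(3,4) space])
       (auto simp: true_discovery_procedure_def)
  have "measure P {\<omega> \<in> \<Omega>. induced_tests d I \<omega> = 1} \<le> \<alpha>"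
    if P: "P \<in> intersection_hypothesis \<P> H I" for P
  proof -
    let ?R = "{\<omega> \<in> \<Omega>. induced_tests d I \<omega> = 1}"
    let ?G = "{\<omega> \<in> \<Omega>. \<forall>S. finite S \<and> S \<subseteq> {1..} \<longrightarrow> d S \<omega> \<le> card (S \<inter> false_nulls H P)}"
    have "P \<in> \<P>"
      using P by (simp add: intersection_hypothesis_def)
    then interpret prob_space P
      using distributions by blast
    have sets: "sets P = sets (limit_algebra \<Omega> F)"
      using distributions \<open>P \<in> \<P>\<close> by blast
    have G: "prob ?G \<ge> 1 - \<alpha>"
      using assms(2) \<open>P \<in> \<P>\<close> by (simp add: true_discovery_procedure_def)
    \<comment> \<open>Non-measurable sets have \<open>measure\<close> zero.\<close>
    then have "?G \<in> events"
      using level(2) measure_notin_sets[of ?G P] by force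
    moreover have "?R \<in> events"
      using measurable_sets[OF meas, of "{1}"] space sets
      by (simp add: vimage_def Int_def conj_commute)
    \<comment> \<open>A rejection comes from a finite \<open>S \<subseteq> I\<close> with
      \<open>d S \<omega> > 0\<close>, but \<open>S\<close> consists of true nulls of
      \<open>P\<close>, so the bound in \<open>?G\<close> forces
      \<open>d S \<omega> = 0\<close>.\<close>
    moreover have "?G \<inter> ?R = {}"
    proof (rule equals0I)
      fix \<omega> assume \<omega>: "\<omega> \<in> ?G \<inter> ?R"
      then have "induced_tests d I \<omega> \<noteq> 0" "\<omega> \<in> \<Omega>"
        by auto
      then obtain S where S: "finite S" "S \<subseteq> I" "d S \<omega> > 0"
        unfolding induced_tests_eq[OF assms(3) \<open>\<omega> \<in> \<Omega>\<close> assms(4)] by auto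
      have "S \<inter> false_nulls H P = {}"
        using S(2) P by (auto simp: intersection_hypothesis_def false_nulls_def true_nulls_def)
      moreover have "d S \<omega> \<le> card (S \<inter> false_nulls H P)"
        using \<omega> S(1,2) assms(4) by blast
      ultimately show False
        using S(3) by simp
    qed
    ultimately have "prob ?G + prob ?R = prob (?G \<union> ?R)"
      by (simp add: finite_measure_Union)
    with G prob_le_1[of "?G \<union> ?R"] show ?thesis
      by linarith
  qed
  with meas show ?thesis
    using induced_tests_eq[OF assms(3) _ assms(4)]
    by (simp add: intersection_test_def)
qed

text \<open>For finite \<open>I\<close> the test is a function of \<open>d I\<close>, known at time
  \<open>Sup I\<close>; for infinite \<open>I\<close> the required algebra is the limit algebra,
  which validity already covers.\<close>

lemma online_intersection_test_induced_tests:
  assumes "online_testing \<Omega> F \<alpha> \<P> H" "true_discovery_procedure \<Omega> F \<alpha> \<P> H d"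
    and "online_procedure \<Omega> F d" "coherent_procedure \<Omega> d" "I \<subseteq> {1..}"
  shows "online_intersection_test \<Omega> F \<alpha> \<P> H I (induced_tests d I)"
proof -
  have test: "intersection_test \<Omega> F \<alpha> \<P> H I (induced_tests d I)"
    using assms(1,2,4,5) by (rule intersection_test_induced_tests)
  moreover have "induced_tests d I \<in> algebra_at \<Omega> F I \<rightarrow>\<^sub>M count_space UNIV"
  proof (cases "finite I")
    case True
    then have [measurable]: "d I \<in> algebra_at \<Omega> F I \<rightarrow>\<^sub>M count_space UNIV"
      using assms(3,5) by (simp add: online_procedure_def)
    have "induced_tests d I = (\<lambda>\<omega>. of_bool (d I \<omega> > 0))"
      using True by (simp add: induced_tests_def fun_eq_iff)
    then show ?thesis
      by simp
  next
    case False
    with test show ?thesis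
      by (simp add: algebra_at_def intersection_test_def)
  qed
  ultimately show ?thesis
    by (simp add: online_intersection_test_def)
qed

lemma increasing_family_induced_tests:
  assumes "coherent_procedure \<Omega> d"
  shows "increasing_family \<Omega> (induced_tests d)"
  unfolding increasing_family_def
proof (intro allI impI ballI, elim conjE)
  fix i :: nat and I K \<omega>
  assume "I \<subseteq> {1..i}" "K \<subseteq> {i<..}" "\<omega> \<in> \<Omega>"
  then have "I \<subseteq> {1..}" "I \<union> K \<subseteq> {1..}"
    by (auto simp: subset_iff)
  with \<open>\<omega> \<in> \<Omega>\<close> show "induced_tests d I \<omega> \<le> induced_tests d (I \<union> K) \<omega>"
    by (auto simp: induced_tests_eq[OF assms] of_bool_def)
qed

lemma closed_procedure_induced_tests_ge:
  assumes "coherent_procedure \<Omega> d" "\<omega> \<in> \<Omega>" "finite S" "S \<subseteq> {1..}"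
  shows "closed_procedure (induced_tests d) S \<omega> \<ge> enat (d S \<omega>)"
  unfolding closed_procedure_def
\<comment> \<open>\<open>enat\<close> is a complete lattice, so a common lower bound suffices even
  if no test accepts.\<close>
proof (rule Inf_greatest, clarify)
  fix I :: "nat set"
  assume "I \<subseteq> {1..}" "induced_tests d I \<omega> = 0"
  \<comment> \<open>\<open>S \<inter> I\<close> is itself one of the finite subsets of
    \<open>I\<close> on which acceptance makes \<open>d\<close> vanish.\<close>
  then have "d (S \<inter> I) \<omega> = 0"
    using assms by (simp add: induced_tests_eq[OF assms(1,2)])
  with coherent_procedure_le[OF assms, of I] show "enat (d S \<omega>) \<le> enat (card (S - I))"
    by simp
qed

theorem theorem2p1:
  fixes \<Omega> :: "'a set" and F :: "nat \<Rightarrow> 'a measure" and \<alpha> :: real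
    and \<P> :: "'a measure set" and H :: "nat \<Rightarrow> 'a measure set"
    and d :: "nat set \<Rightarrow> 'a \<Rightarrow> nat"
  assumes "online_testing \<Omega> F \<alpha> \<P> H"
    and "true_discovery_procedure \<Omega> F \<alpha> \<P> H d"
    and "online_procedure \<Omega> F d"
    and "coherent_procedure \<Omega> d"
  defines "\<phi> \<equiv> induced_tests d"
  shows "(\<forall>I\<subseteq>{1..}. online_intersection_test \<Omega> F \<alpha> \<P> H I (\<phi> I)) \<and>
         increasing_family \<Omega> \<phi> \<and>
         (\<forall>S. finite S \<and> S \<subseteq> {1..} \<longrightarrow> (\<forall>\<omega>\<in>\<Omega>. closed_procedure \<phi> S \<omega> \<ge> enat (d S \<omega>)))"
  unfolding \<phi>_def
  using online_intersection_test_induced_tests[OF assms(1-4)]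
    increasing_family_induced_tests[OF assms(4)] closed_procedure_induced_tests_ge[OF assms(4)]
  by blast

end
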